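(* Let $X$ be a complex Banach space, let $A$ be a bounded linear operator on $X$, let $p>0$, and let $K\in\mathcal S_{p,\infty}^{(e)}(X)$. Then $$ n_{A+K}(s) \leq \frac{\ln(2)}{2}\, \frac{\Phi_p\left(\frac{\|A\|}{s}\right)}{s^p}\, \|K\|_{p,\infty}^p \qquad \text{for all } s>\|A\|. $$ In particular, $$ n_{A+K}(s) \leq C_p\, \frac{s}{(s-\|A\|)^{p+1}}\, \|K\|_{p,\infty}^p \qquad \text{for all } s>\|A\|, $$ where $C_p := \dfrac{\ln(2)\,(p+1)^{p+1}}{2p^p}$.
   Context: Entropy numbers: for a bounded linear operator $T$ on $X$ with closed unit ball $B_X$ and $n\in\mathbb N=\{1,2,\dots\}$, $e_n(T)$ is the infimum of all $\varepsilon>0$ for which there exist $q\le 2^{n-1}$ and $y_1,\dots,y_q\in X$ with $T(B_X)\subset\bigcup_{i=1}^q(\{y_i\}+\varepsilon B_X)$. For $p>0$, $\mathcal S_{p,\infty}^{(e)}(X)$ is the set of bounded operators $T$ on $X$ with $\|T\|_{p,\infty}:=\sup_{n\in\mathbb N} n^{1/p}e_n(T)<\infty$ (such operators are compact). The discrete spectrum of a bounded operator consists of all its isolated eigenvalues of finite algebraic multiplicity (discrete eigenvalues). The essential spectrum $\sigma_{ess}(A)$ is the set of $\lambda\in\mathbb C$ such that $\lambda-A$ is not a Fredholm operator. For $K$ compact and $s>0$ with $s>|\lambda|$ for all $\lambda\in\sigma_{ess}(A)$, $n_{A+K}(s)$ denotes the number of discrete eigenvalues $\lambda$ of $A+K$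 with $|\lambda|>s$, each counted as many times as its algebraic multiplicity. The function $\Phi_p:[0,1)\to\mathbb R$ is defined by $$\Phi_p(x)=\frac{\left(W\left(\frac1p e^{\frac1p}x\right)\right)^p}{\left(\frac1p-W\left(\frac1p e^{\frac1p}x\right)\right)^{p+1}x^p}\quad (0<x<1),\qquad \Phi_p(0)=p\cdot e,$$ where $W:[0,\infty)\to[0,\infty)$ is the Lambert $W$-function, defined by $W(x)e^{W(x)}=x$. *)

theory Defs
  imports "HOL-Analysis.Analysis"
begin

class complex_banach = banach +
  fixes scaleC :: "complex \<Rightarrow> 'a \<Rightarrow> 'a"  (infixr \<open>*\<^sub>C\<close> 75)
  assumes scaleC_add_right: "a *\<^sub>C (x + y) = a *\<^sub>C x + a *\<^sub>C y"
    and scaleC_add_left: "(a + b) *\<^sub>C x = a *\<^sub>C x + b *\<^sub>C x"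
    and scaleC_scaleC: "a *\<^sub>C b *\<^sub>C x = (a * b) *\<^sub>C x"
    and scaleC_of_real: "complex_of_real r *\<^sub>C x = r *\<^sub>R x"
    and norm_scaleC: "norm (a *\<^sub>C x) = cmod a * norm x"

instantiation complex :: complex_banach
begin

definition scaleC_complex :: "complex \<Rightarrow> complex \<Rightarrow> complex" where
  "scaleC_complex a x = a * x"

instance
  by standard (simp_all add: scaleC_complex_def algebra_simps norm_mult scaleR_conv_of_real)

end

global_interpretation complex_vector:
  vector_space "scaleC :: complex \<Rightarrow> 'a \<Rightarrow> 'a::complex_banach"
  defines cspan = complex_vector.span
    and cdim = complex_vector.dim
proof
  fix x :: 'a
  have "complex_of_real 1 *\<^sub>C x = x"
    by (simp only: scaleC_of_real scaleR_one)
  then show "1 *\<^sub>C x = x"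
    by simp
qed (simp_all only: scaleC_add_right scaleC_add_left scaleC_scaleC)

definition bounded_clinear :: "('a::complex_banach \<Rightarrow> 'b::complex_banach) \<Rightarrow> bool" where
  "bounded_clinear T \<longleftrightarrow> bounded_linear T \<and> (\<forall>c x. T (c *\<^sub>C x) = c *\<^sub>C T x)"


subsection \<open>Entropy numbers\<close>

text \<open>The index starts at \<open>n = 1\<close>; the value at \<open>n = 0\<close> is never used.\<close>

definition entropy_number :: "nat \<Rightarrow> ('a::complex_banach \<Rightarrow> 'a) \<Rightarrow> real" where
  "entropy_number n T =
     Inf {\<epsilon>. \<epsilon> > 0 \<and> (\<exists>Y. finite Y \<and> card Y \<le> 2 ^ (n - 1) \<and> T ` cball 0 1 \<subseteq> (\<Union>y\<in>Y. cball y \<epsilon>))}"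

definition entropy_class :: "real \<Rightarrow> ('a::complex_banach \<Rightarrow> 'a) set" where
  "entropy_class p =
     {T. bounded_clinear T \<and> bdd_above ((\<lambda>n. real n powr (1 / p) * entropy_number n T) ` {1..})}"

text \<open>A real supremum, hence only meaningful on \<^const>\<open>entropy_class\<close>.\<close>

definition entropy_quasinorm :: "real \<Rightarrow> ('a::complex_banach \<Rightarrow> 'a) \<Rightarrow> real" where
  "entropy_quasinorm p T = (SUP n\<in>{1..}. real n powr (1 / p) * entropy_number n T)"


subsection \<open>Discrete eigenvalues\<close>

definition spectrum :: "('a::complex_banach \<Rightarrow> 'a) \<Rightarrow> complex set" where
  "spectrum T = {z. \<not> (\<exists>R. bounded_clinear R \<and>
     (\<forall>x. R (z *\<^sub>C x - T x) = x) \<and> (\<forall>x. z *\<^sub>C R x - T (R x) = x))}"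

definition eigenvalue :: "('a::complex_banach \<Rightarrow> 'a) \<Rightarrow> complex \<Rightarrow> bool" where
  "eigenvalue T z \<longleftrightarrow> (\<exists>x. x \<noteq> 0 \<and> T x = z *\<^sub>C x)"

definition generalized_eigenspace :: "('a::complex_banach \<Rightarrow> 'a) \<Rightarrow> complex \<Rightarrow> 'a set" where
  "generalized_eigenspace T z = {x. \<exists>k. ((\<lambda>y. z *\<^sub>C y - T y) ^^ k) x = 0}"

definition finite_alg_mult :: "('a::complex_banach \<Rightarrow> 'a) \<Rightarrow> complex \<Rightarrow> bool" where
  "finite_alg_mult T z \<longleftrightarrow> (\<exists>B. finite B \<and> generalized_eigenspace T z \<subseteq> cspan B)"

text \<open>Only meaningful under \<^const>\<open>finite_alg_mult\<close>, since \<^const>\<open>cdim\<close> is \<open>0\<close> on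
  infinite-dimensional spaces.\<close>

definition alg_mult :: "('a::complex_banach \<Rightarrow> 'a) \<Rightarrow> complex \<Rightarrow> nat" where
  "alg_mult T z = cdim (generalized_eigenspace T z)"

text \<open>Whenever the Riesz projection of an isolated eigenvalue has finite rank, its range is the
  generalized eigenspace, so the multiplicities agree with the ranks of the Riesz projections; outside
  the essential spectrum both notions of finite multiplicity coincide.\<close>

definition discrete_spectrum :: "('a::complex_banach \<Rightarrow> 'a) \<Rightarrow> complex set" where
  "discrete_spectrum T =
     {z. z isolated_in spectrum T \<and> eigenvalue T z \<and> finite_alg_mult T z}"

text \<open>The count is extended: a priori there could be infinitely many discrete eigenvalues
  outside the disc, and a finite upper bound has to exclude this.\<close>

definition eigenvalue_count :: "('a::complex_banach \<Rightarrow> 'a) \<Rightarrow> real \<Rightarrow> enat" where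
  "eigenvalue_count T s =
     (let D = {z \<in> discrete_spectrum T. cmod z > s}
      in if finite D then enat (\<Sum>z\<in>D. alg_mult T z) else \<infinity>)"


subsection \<open>The bounding function\<close>

definition Lambert_W :: "real \<Rightarrow> real" where
  "Lambert_W x = (THE w. w \<ge> 0 \<and> w * exp w = x)"

definition Phi :: "real \<Rightarrow> real \<Rightarrow> real" where
  "Phi p x =
     (if x = 0 then p * exp 1
      else let w = Lambert_W (1 / p * exp (1 / p) * x)
           in w powr p / ((1 / p - w) powr (p + 1) * x powr p))"

end

theory Submission
  imports Defs
begin

text \<open>
  The unit ball of a complex space of dimension \<open>N\<close> has real dimension \<open>2 N\<close>. If \<open>T = A + K\<close>
  leaves such a space invariant and has only eigenvalues of modulus larger than \<open>s\<close> on it, then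
  \<open>T\<close> multiplies volume there by more than \<open>s ^ (2 N)\<close>. On the other hand the image of the unit
  ball under \<open>K\<close> is covered by \<open>2 ^ (n - 1)\<close> balls of any radius \<open>\<epsilon> > e\<^sub>n (K)\<close>, hence the image
  under \<open>T\<close> is covered by as many balls of radius \<open>\<parallel>A\<parallel> + \<epsilon>\<close>. The comparison gives Carl's
  inequality in the form \<open>s ^ (2 N) \<le> 2 ^ (n - 1) * (\<parallel>A\<parallel> + \<epsilon>) ^ (2 N)\<close>. It is applied to the sum of
  the generalized eigenspaces of finitely many discrete eigenvalues outside the disc of radius \<open>s\<close>,
  where \<open>N\<close> is their total multiplicity (\<open>multiplicity_power_le_cover\<close>).

  The covering centres may lie outside the invariant subspace, so that a direct comparison of
  volumes would lose a constant factor. Passing to \<open>T\<^sup>k\<close>, with at most \<open>q\<^sup>k\<close> balls of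
  radius \<open>\<rho>\<^sup>k\<close>, and letting \<open>k\<close> tend to infinity removes all such factors (\<open>expansion_le_cover\<close>). This permits a crude substitute for volume,
  the number of points of a grid in a fixed basis (\<open>grid_card_le_cover_card\<close>), and a crude
  substitute for the determinant, the lower bound \<open>norm (T\<^sup>k x) \<ge> c * s\<^sup>k * norm x\<close> on the sum of
  the generalized eigenspaces (\<open>expanding_family_of_generalized_eigenvectors\<close>).

  Choosing \<open>n\<close> just above \<open>2 N t / ln 2\<close> turns Carl's inequality into
  \<open>s * exp (- t) - \<parallel>A\<parallel> \<le> e\<^sub>n (K)\<close>, and the bound \<open>e\<^sub>n (K) \<le> \<parallel>K\<parallel> * n powr (- 1 / p)\<close>, with the
  entropy quasinorm of \<open>K\<close>, solves for \<open>N\<close>: for every \<open>t > 0\<close> with \<open>s * exp (- t) > \<parallel>A\<parallel>\<close> the multiplicity is at most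
  \<open>ln 2 / 2 * \<parallel>K\<parallel> powr p / (t * (s * exp (- t) - \<parallel>A\<parallel>) powr p)\<close> (\<open>total_multiplicity_le\<close>). The best
  \<open>t\<close> is expressed by the Lambert function and produces \<open>Phi\<close>; replacing \<open>exp (- t)\<close> by \<open>1 - t\<close>
  before optimizing produces the second, explicit bound.
\<close>


section \<open>Bounded complex-linear maps\<close>

lemma bounded_clinear_imp_bounded_linear: "bounded_clinear T \<Longrightarrow> bounded_linear T"
  by (simp add: bounded_clinear_def)

lemma bounded_clinear_scaleC: "bounded_clinear T \<Longrightarrow> T (c *\<^sub>C x) = c *\<^sub>C T x"
  by (simp add: bounded_clinear_def)

lemma bounded_linear_scaleC_right: "bounded_linear (\<lambda>x::'a::complex_banach. c *\<^sub>C x)"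
proof (rule bounded_linear_intro[where K = "cmod c"])
  fix r :: real and x :: 'a
  show "c *\<^sub>C r *\<^sub>R x = r *\<^sub>R c *\<^sub>C x"
    by (metis mult.commute scaleC_of_real scaleC_scaleC)
qed (simp_all add: scaleC_add_right norm_scaleC mult.commute)

lemma bounded_clinear_funpow:
  fixes T :: "'a::complex_banach \<Rightarrow> 'a"
  assumes "bounded_clinear T"
  shows "bounded_clinear (T ^^ k)"
proof (induction k)
  case 0
  then show ?case by (simp add: bounded_clinear_def id_def)
next
  case (Suc k)
  then show ?case
    using assms bounded_linear_compose[of T "T ^^ k"] by (simp add: bounded_clinear_def o_def)
qed

lemma bounded_clinear_add:
  assumes "bounded_clinear S" "bounded_clinear T"
  shows "bounded_clinear (\<lambda>x. S x + T x)"
  using assms bounded_linear_add[of S T] by (simp add: bounded_clinear_def scaleC_add_right)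

lemma bounded_clinear_shift:
  assumes "bounded_clinear T"
  shows "bounded_clinear (\<lambda>y. z *\<^sub>C y - T y)"
proof -
  have "bounded_linear (\<lambda>y. z *\<^sub>C y - T y)"
    using assms by (intro bounded_linear_sub bounded_linear_scaleC_right)
      (simp add: bounded_clinear_def)
  moreover have "z *\<^sub>C c *\<^sub>C y - T (c *\<^sub>C y) = c *\<^sub>C (z *\<^sub>C y - T y)" for c y
    using assms
    by (simp add: bounded_clinear_def complex_vector.scale_right_diff_distrib scaleC_scaleC mult.commute)
  ultimately show ?thesis by (simp add: bounded_clinear_def)
qed

lemma clinear_sum: "bounded_clinear T \<Longrightarrow> T (\<Sum>i\<in>I. f i) = (\<Sum>i\<in>I. T (f i))"
  by (simp add: bounded_clinear_imp_bounded_linear bounded_linear.linear linear_sum)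

lemma clinear_0: "bounded_clinear T \<Longrightarrow> T 0 = 0"
  by (simp add: bounded_clinear_imp_bounded_linear bounded_linear.linear linear_0)

lemma clinear_add: "bounded_clinear T \<Longrightarrow> T (x + y) = T x + T y"
  by (simp add: bounded_clinear_imp_bounded_linear bounded_linear.linear linear_add)

lemma clinear_diff: "bounded_clinear T \<Longrightarrow> T (x - y) = T x - T y"
  by (simp add: bounded_clinear_imp_bounded_linear bounded_linear.linear linear_diff)

lemma funpow_commute_linear:
  assumes "\<And>x. f (g x) = g (f x)"
  shows "(f ^^ k) (g x) = g ((f ^^ k) x)"
  by (induction k) (simp_all add: assms)


section \<open>Finite families of linearly independent vectors\<close>

text \<open>This is the equivalence of norms on a finite-dimensional space. After dividing by the
  largest coefficient, the coefficients range over a compact product of discs in which one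
  coordinate equals one; there the norm of the combination is continuous and never vanishes.\<close>

lemma coefficient_bound_of_independent_family:
  fixes b :: "'i \<Rightarrow> 'a::complex_banach"
  assumes fin: "finite I"
    and ind: "\<And>f. (\<Sum>i\<in>I. f i *\<^sub>C b i) = 0 \<Longrightarrow> \<forall>i\<in>I. f i = 0"
  obtains c where "c > 0" "\<And>f j. j \<in> I \<Longrightarrow> c * cmod (f j) \<le> norm (\<Sum>i\<in>I. f i *\<^sub>C b i)"
proof -
  define g where "g f = norm (\<Sum>i\<in>I. f i *\<^sub>C b i)" for f :: "'i \<Rightarrow> complex"
  \<comment> \<open>Coordinates outside \<open>I\<close> are pinned to zero, which makes \<open>S j\<close> compact in the space of all
    functions on the index type.\<close>
  define S where "S j = (\<Pi>\<^sub>E i\<in>UNIV. if i = j then {1::complex} else if i \<in> I then cball 0 1 else {0})" for j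
  have bl: "bounded_linear (\<lambda>c. c *\<^sub>C x)" for x :: 'a
  proof (rule bounded_linear_intro[where K = "norm x"])
    show "(r *\<^sub>R c) *\<^sub>C x = r *\<^sub>R c *\<^sub>C x" for r c
      by (metis scaleC_of_real scaleC_scaleC scaleR_conv_of_real)
  qed (simp_all add: scaleC_add_left norm_scaleC)
  have contg: "continuous_on A g" for A
    unfolding g_def
    by (intro continuous_intros bounded_linear.continuous_on[OF bl]
        continuous_on_subset[OF continuous_on_product_coordinates]) auto
  have Scomp: "compact (S j)" for j
  proof -
    have "compactin (product_topology (\<lambda>_. euclidean) UNIV) (S j)"
      unfolding S_def by (subst compactin_PiE) auto
    then show ?thesis by (simp add: euclidean_product_topology)
  qed
  have "\<exists>c>0. \<forall>f\<in>S j. c \<le> g f" if j: "j \<in> I" for j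
  proof -
    have "(\<lambda>i. if i = j then 1 else 0) \<in> S j" by (auto simp: S_def)
    then have "S j \<noteq> {}" by blast
    from continuous_attains_inf[OF Scomp this contg]
    obtain f where f: "f \<in> S j" "\<forall>h\<in>S j. g f \<le> g h" by blast
    have "f j = 1" using f(1) by (auto simp: S_def PiE_def Pi_def split: if_splits)
    then have "g f > 0" using ind[of f] j by (auto simp: g_def)
    with f(2) show ?thesis by blast
  qed
  then obtain c where c: "\<And>j. j \<in> I \<Longrightarrow> c j > 0" "\<And>j f. j \<in> I \<Longrightarrow> f \<in> S j \<Longrightarrow> c j \<le> g f"
    by metis
  show ?thesis
  proof (cases "I = {}")
    case True
    then show ?thesis using that[of 1] by simp
  next
    case False
    define d where "d = Min (c ` I)"
    have d: "d > 0" "\<And>j. j \<in> I \<Longrightarrow> d \<le> c j" using c fin False by (auto simp: d_def)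
    show ?thesis
    proof (rule that[OF d(1)])
      fix f :: "'i \<Rightarrow> complex" and j assume j: "j \<in> I"
      have "Max ((\<lambda>i. cmod (f i)) ` I) \<in> (\<lambda>i. cmod (f i)) ` I"
        using fin False by (intro Max_in) auto
      then obtain m where m: "m \<in> I" "Max ((\<lambda>i. cmod (f i)) ` I) = cmod (f m)" by blast
      have fm: "cmod (f i) \<le> cmod (f m)" if "i \<in> I" for i
        unfolding m(2)[symmetric] using fin that by auto
      show "d * cmod (f j) \<le> norm (\<Sum>i\<in>I. f i *\<^sub>C b i)"
      proof (cases "f m = 0")
        case True
        then show ?thesis using fm[OF j] by simp
      next
        case fm0: False
        define h where "h i = (if i \<in> I then f i / f m else 0)" for i
        have "h \<in> S m"
          using fm fm0 m by (auto simp: h_def S_def norm_divide)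
        then have "d \<le> g h" using c(2)[OF m(1)] d(2)[OF m(1)] by force
        have "(\<Sum>i\<in>I. f i *\<^sub>C b i) = (\<Sum>i\<in>I. f m *\<^sub>C h i *\<^sub>C b i)"
          using fm0 by (intro sum.cong) (auto simp: h_def scaleC_scaleC)
        also have "\<dots> = f m *\<^sub>C (\<Sum>i\<in>I. h i *\<^sub>C b i)"
          by (simp add: complex_vector.scale_sum_right)
        finally have "norm (\<Sum>i\<in>I. f i *\<^sub>C b i) = cmod (f m) * g h"
          by (simp add: norm_scaleC g_def)
        moreover have "d * cmod (f j) \<le> g h * cmod (f m)"
          using \<open>d \<le> g h\<close> fm[OF j] d(1) by (intro mult_mono) auto
        ultimately show ?thesis by (simp add: mult.commute)
      qed
    qed
  qed
qed


section \<open>Growth of iterates on generalized eigenspaces\<close>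

text \<open>The quantity \<open>M x = (\<Sum>i\<le>m. norm (N\<^sup>i x) / \<delta>\<^sup>i)\<close> is an equivalent norm in which the
  nilpotent part \<open>N\<close> has norm at most \<open>\<delta>\<close>. With \<open>\<delta> = cmod z - s\<close> a single application of
  \<open>T = z - N\<close> multiplies \<open>M\<close> by at least \<open>s\<close>, so no polynomial factors in \<open>k\<close> arise.\<close>

lemma iterates_expand_on_kernel_of_power:
  assumes T: "bounded_clinear T" and s: "0 < s" "s < cmod z"
  obtains c where "c > 0"
    "\<And>x k. ((\<lambda>y. z *\<^sub>C y - T y) ^^ m) x = 0 \<Longrightarrow> c * s ^ k * norm x \<le> norm ((T ^^ k) x)"
proof -
  define N where "N y = z *\<^sub>C y - T y" for y
  define \<delta> where "\<delta> = cmod z - s"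
  have \<delta>: "\<delta> > 0" using s by (simp add: \<delta>_def)
  have N: "bounded_clinear N" unfolding N_def by (rule bounded_clinear_shift[OF T])
  have Ni: "bounded_clinear (N ^^ i)" for i by (rule bounded_clinear_funpow[OF N])
  have blNi: "bounded_linear (N ^^ i)" for i
    using Ni by (rule bounded_clinear_imp_bounded_linear)
  have commNT: "N (T x) = T (N x)" for x
    using T by (simp add: N_def bounded_clinear_scaleC clinear_diff)
  define M where "M x = (\<Sum>i\<le>m. norm ((N ^^ i) x) / \<delta> ^ i)" for x
  define C where "C = (\<Sum>i\<le>m. onorm (N ^^ i) / \<delta> ^ i) + 1"
  have C: "C > 0"
    unfolding C_def using \<delta>
    by (intro add_nonneg_pos sum_nonneg divide_nonneg_nonneg onorm_pos_le blNi) auto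
  have MC: "M x \<le> C * norm x" for x
  proof -
    have "M x \<le> (\<Sum>i\<le>m. (onorm (N ^^ i) / \<delta> ^ i) * norm x)"
      unfolding M_def using \<delta> onorm[OF blNi, of _ x]
      by (intro sum_mono) (simp add: divide_right_mono)
    also have "\<dots> = (C - 1) * norm x" by (simp add: C_def sum_distrib_right)
    also have "\<dots> \<le> C * norm x" by (simp add: mult_right_mono)
    finally show ?thesis .
  qed
  have Mn: "norm x \<le> M x" for x
  proof -
    have "(\<lambda>i. norm ((N ^^ i) x) / \<delta> ^ i) 0 \<le> M x"
      unfolding M_def using \<delta> by (intro member_le_sum) auto
    then show ?thesis by simp
  qed
  have MT: "s * M x \<le> M (T x)" if x: "(N ^^ m) x = 0" for x
  proof -
    have "(\<Sum>i\<le>m. norm ((N ^^ Suc i) x) / \<delta> ^ i) = \<delta> * (\<Sum>i\<le>m. norm ((N ^^ Suc i) x) / \<delta> ^ Suc i)"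
      using \<delta> by (simp add: sum_distrib_left)
    also have "(\<Sum>i\<le>m. norm ((N ^^ Suc i) x) / \<delta> ^ Suc i)
        = (\<Sum>i\<le>Suc m. norm ((N ^^ i) x) / \<delta> ^ i) - norm x"
      by (subst sum.atMost_Suc_shift) simp
    also have "(\<Sum>i\<le>Suc m. norm ((N ^^ i) x) / \<delta> ^ i) = M x"
      using x by (simp add: M_def clinear_0[OF N])
    also have "\<delta> * (M x - norm x) \<le> \<delta> * M x" using \<delta> by simp
    finally have 1: "(\<Sum>i\<le>m. norm ((N ^^ Suc i) x) / \<delta> ^ i) \<le> \<delta> * M x" .
    have each: "cmod z * norm ((N ^^ i) x) - norm ((N ^^ Suc i) x) \<le> norm ((N ^^ i) (T x))" for i
    proof -
      have "(N ^^ i) (T x) = (N ^^ i) (z *\<^sub>C x - N x)" by (simp add: N_def)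
      also have "\<dots> = z *\<^sub>C (N ^^ i) x - (N ^^ i) (N x)"
        by (simp add: clinear_diff[OF Ni] bounded_clinear_scaleC[OF Ni])
      also have "(N ^^ i) (N x) = (N ^^ Suc i) x" by (simp add: funpow_swap1)
      finally have "(N ^^ i) (T x) = z *\<^sub>C (N ^^ i) x - (N ^^ Suc i) x" .
      then show ?thesis
        by (metis norm_scaleC norm_triangle_ineq2)
    qed
    have "cmod z * M x - (\<Sum>i\<le>m. norm ((N ^^ Suc i) x) / \<delta> ^ i)
        = (\<Sum>i\<le>m. (cmod z * norm ((N ^^ i) x) - norm ((N ^^ Suc i) x)) / \<delta> ^ i)"
      by (simp add: M_def sum_distrib_left sum_subtractf[symmetric] diff_divide_distrib)
    also have "\<dots> \<le> M (T x)"
      unfolding M_def using \<delta> each by (intro sum_mono divide_right_mono) auto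
    finally show ?thesis using 1 by (simp add: \<delta>_def algebra_simps)
  qed
  have grow: "s ^ k * M x \<le> M ((T ^^ k) x)" if x: "(N ^^ m) x = 0" for x k
  proof (induction k)
    case (Suc k)
    have "(N ^^ m) ((T ^^ k) x) = (T ^^ k) ((N ^^ m) x)"
      by (intro funpow_commute_linear funpow_commute_linear[symmetric]) (simp add: commNT)
    also have "\<dots> = 0"
      using x by (simp add: clinear_0[OF bounded_clinear_funpow[OF T]])
    finally have "s * M ((T ^^ k) x) \<le> M ((T ^^ Suc k) x)" using MT by simp
    moreover have "s * (s ^ k * M x) \<le> s * M ((T ^^ k) x)"
      using Suc s by (intro mult_left_mono) auto
    ultimately show ?case by (simp add: mult_ac)
  qed simp
  show ?thesis
  proof (rule that[of "1 / C"])
    fix x k assume "((\<lambda>y. z *\<^sub>C y - T y) ^^ m) x = 0"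
    then have x: "(N ^^ m) x = 0" by (simp add: N_def[abs_def])
    have "s ^ k * norm x \<le> s ^ k * M x" using s Mn by (intro mult_left_mono) auto
    also have "\<dots> \<le> C * norm ((T ^^ k) x)" using grow[OF x, of k] MC order_trans by blast
    finally show "1 / C * s ^ k * norm x \<le> norm ((T ^^ k) x)"
      using C by (simp add: field_simps)
  qed (use C in auto)
qed

lemma funpow_kernel_mono:
  fixes T :: "'a::complex_banach \<Rightarrow> 'a"
  assumes "bounded_clinear T" "(T ^^ k) x = 0" "k \<le> m"
  shows "(T ^^ m) x = 0"
proof -
  have "(T ^^ m) x = (T ^^ (m - k)) ((T ^^ k) x)"
    using assms(3) by (metis comp_apply funpow_add le_add_diff_inverse2)
  then show ?thesis
    using assms bounded_clinear_funpow clinear_0 by metis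
qed

lemma subspace_generalized_eigenspace:
  assumes T: "bounded_clinear T"
  shows "complex_vector.subspace (generalized_eigenspace T z)"
proof -
  let ?N = "\<lambda>y. z *\<^sub>C y - T y"
  have N: "bounded_clinear ?N" by (rule bounded_clinear_shift[OF T])
  note Nk = bounded_clinear_funpow[OF N]
  show ?thesis
  proof (rule complex_vector.subspaceI)
    show "0 \<in> generalized_eigenspace T z"
      by (auto simp: generalized_eigenspace_def clinear_0[OF Nk])
    fix x assume "x \<in> generalized_eigenspace T z"
    then obtain k where k: "(?N ^^ k) x = 0" by (auto simp: generalized_eigenspace_def)
    then show "c *\<^sub>C x \<in> generalized_eigenspace T z" for c
      by (auto simp: generalized_eigenspace_def bounded_clinear_scaleC[OF Nk] intro!: exI[of _ k])
    fix y assume "y \<in> generalized_eigenspace T z"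
    then obtain l where l: "(?N ^^ l) y = 0" by (auto simp: generalized_eigenspace_def)
    have "(?N ^^ max k l) (x + y) = 0"
      using funpow_kernel_mono[OF N k, of "max k l"] funpow_kernel_mono[OF N l, of "max k l"]
      by (simp add: clinear_add[OF Nk])
    then show "x + y \<in> generalized_eigenspace T z" unfolding generalized_eigenspace_def by blast
  qed
qed

lemma generalized_eigenspace_invariant:
  assumes T: "bounded_clinear T" and S: "bounded_clinear S" "\<And>x. S (T x) = T (S x)"
    and x: "x \<in> generalized_eigenspace T z"
  shows "S x \<in> generalized_eigenspace T z"
proof -
  let ?N = "\<lambda>y. z *\<^sub>C y - T y"
  obtain k where k: "(?N ^^ k) x = 0" using x by (auto simp: generalized_eigenspace_def)
  have "?N (S y) = S (?N y)" for y
    by (simp add: clinear_diff[OF S(1)] bounded_clinear_scaleC[OF S(1)] S(2))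
  then have "(?N ^^ k) (S x) = S ((?N ^^ k) x)" by (rule funpow_commute_linear)
  then show ?thesis using k clinear_0[OF S(1)] unfolding generalized_eigenspace_def by auto
qed

text \<open>An eigenvector for \<open>w\<close> inside the generalized eigenspace at \<open>z\<close> is multiplied by
  \<open>z - w \<noteq> 0\<close> under \<open>z - T\<close>, which contradicts nilpotency unless the vector vanishes.\<close>

lemma shift_injective_on_other_generalized_eigenspace:
  assumes T: "bounded_clinear T" and x: "x \<in> generalized_eigenspace T z" and "w \<noteq> z"
    and "((\<lambda>y. w *\<^sub>C y - T y) ^^ k) x = 0"
  shows "x = 0"
  using x assms(4)
proof (induction k arbitrary: x)
  case (Suc k)
  let ?N = "\<lambda>y. w *\<^sub>C y - T y"
  have "?N x \<in> generalized_eigenspace T z"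
    by (rule generalized_eigenspace_invariant[OF T bounded_clinear_shift[OF T] _ Suc.prems(1)])
      (simp add: clinear_diff[OF T] bounded_clinear_scaleC[OF T])
  moreover have "(?N ^^ k) (?N x) = 0" using Suc.prems(2) by (metis comp_apply funpow_Suc_right)
  ultimately have "?N x = 0" by (rule Suc.IH)
  then have Tx: "T x = w *\<^sub>C x" by simp
  have pow: "((\<lambda>y. z *\<^sub>C y - T y) ^^ j) x = (z - w) ^ j *\<^sub>C x" for j
    by (induction j)
      (simp_all add: bounded_clinear_scaleC[OF T] Tx scaleC_scaleC algebra_simps
        complex_vector.scale_left_diff_distrib)
  obtain j where "((\<lambda>y. z *\<^sub>C y - T y) ^^ j) x = 0"
    using Suc.prems(1) by (auto simp: generalized_eigenspace_def)
  then show ?case using pow[of j] \<open>w \<noteq> z\<close> by simp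
qed simp

text \<open>A power of \<open>w - T\<close> removes the component at \<open>w\<close> from a vanishing sum and
  is injective on the other components, which gives an induction over the eigenvalues.\<close>

lemma generalized_eigenspaces_independent:
  assumes T: "bounded_clinear T" and "finite D"
    and "\<And>z. z \<in> D \<Longrightarrow> x z \<in> generalized_eigenspace T z" and "(\<Sum>z\<in>D. x z) = 0"
  shows "\<forall>z\<in>D. x z = 0"
  using assms(2-4)
proof (induction D arbitrary: x rule: finite_induct)
  case (insert w D)
  let ?N = "\<lambda>y. w *\<^sub>C y - T y"
  obtain k where k: "(?N ^^ k) (x w) = 0"
    using insert.prems(1)[of w] by (auto simp: generalized_eigenspace_def)
  have L: "bounded_clinear (?N ^^ k)" by (intro bounded_clinear_funpow bounded_clinear_shift T)
  have comm: "(?N ^^ k) (T y) = T ((?N ^^ k) y)" for y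
    by (rule funpow_commute_linear) (simp add: clinear_diff[OF T] bounded_clinear_scaleC[OF T])
  have "(?N ^^ k) (\<Sum>z\<in>insert w D. x z) = 0" using insert.prems(2) clinear_0[OF L] by simp
  then have "(\<Sum>z\<in>D. (?N ^^ k) (x z)) = 0"
    using insert.hyps k by (simp add: clinear_add[OF L] clinear_sum[OF L])
  moreover have "(?N ^^ k) (x z) \<in> generalized_eigenspace T z" if "z \<in> D" for z
    using insert.prems(1) that by (intro generalized_eigenspace_invariant[OF T L comm]) auto
  ultimately have "\<forall>z\<in>D. (?N ^^ k) (x z) = 0" by (intro insert.IH) auto
  then have "\<forall>z\<in>D. x z = 0"
    using shift_injective_on_other_generalized_eigenspace[OF T] insert.prems(1) insert.hyps(2)
    by (metis insertI2)
  then show ?case using insert.prems(2) insert.hyps by simp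
qed simp

lemma finite_generalized_eigenspace_exponent:
  assumes T: "bounded_clinear T" and "finite B" "B \<subseteq> generalized_eigenspace T z"
  obtains m where "\<And>x. x \<in> cspan B \<Longrightarrow> ((\<lambda>y. z *\<^sub>C y - T y) ^^ m) x = 0"
proof -
  let ?N = "\<lambda>y. z *\<^sub>C y - T y"
  have N: "bounded_clinear ?N" by (rule bounded_clinear_shift[OF T])
  obtain k where k: "\<And>b. b \<in> B \<Longrightarrow> (?N ^^ k b) b = 0"
    using assms(3) unfolding generalized_eigenspace_def by (simp add: subset_iff) metis
  obtain m where m: "\<And>b. b \<in> B \<Longrightarrow> k b \<le> m"
    using \<open>finite B\<close> by (metis finite_imageI finite_nat_set_iff_bounded_le imageI)
  show ?thesis
  proof (rule that)
    fix x assume "x \<in> cspan B"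
    then obtain u where "x = (\<Sum>b\<in>B. u b *\<^sub>C b)"
      using complex_vector.span_finite[OF \<open>finite B\<close>] by auto
    moreover have "(?N ^^ m) b = 0" if "b \<in> B" for b
      using funpow_kernel_mono[OF N k[OF that] m[OF that]] .
    ultimately show "(?N ^^ m) x = 0"
      by (simp add: clinear_sum[OF bounded_clinear_funpow[OF N]]
          bounded_clinear_scaleC[OF bounded_clinear_funpow[OF N]])
  qed
qed

text \<open>The estimates on the single generalized eigenspaces combine because the coefficient bound
  controls the norm of each component of a vector by the norm of the vector itself, both
  before and after the iteration.\<close>

lemma expanding_family_of_generalized_eigenvectors:
  fixes T :: "'a::complex_banach \<Rightarrow> 'a"
  assumes T: "bounded_clinear T" and "finite D" and s: "s > 0"
    and D: "\<And>z. z \<in> D \<Longrightarrow> s < cmod z \<and> finite_alg_mult T z"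
  obtains I :: "(complex \<times> 'a) set" and c where "c > 0"
    "finite I" "card I = (\<Sum>z\<in>D. alg_mult T z)"
    "\<And>f. (\<Sum>i\<in>I. f i *\<^sub>C snd i) = 0 \<Longrightarrow> \<forall>i\<in>I. f i = 0"
    "\<And>f k. c * s ^ k * norm (\<Sum>i\<in>I. f i *\<^sub>C snd i) \<le> norm ((T ^^ k) (\<Sum>i\<in>I. f i *\<^sub>C snd i))"
proof -
  have "\<exists>B. finite B \<and> B \<subseteq> generalized_eigenspace T z \<and> complex_vector.independent B
      \<and> generalized_eigenspace T z \<subseteq> cspan B \<and> card B = alg_mult T z" if z: "z \<in> D" for z
  proof -
    obtain F where F: "finite F" "generalized_eigenspace T z \<subseteq> cspan F"
      using D[OF z] by (auto simp: finite_alg_mult_def)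
    obtain B where B: "B \<subseteq> generalized_eigenspace T z" "complex_vector.independent B"
      "generalized_eigenspace T z \<subseteq> cspan B" "card B = cdim (generalized_eigenspace T z)"
      by (rule complex_vector.basis_exists)
    have "finite B" using complex_vector.independent_span_bound[OF F(1) B(2)] B(1) F(2) by blast
    then show ?thesis using B by (auto simp: alg_mult_def)
  qed
  then obtain B where B: "\<And>z. z \<in> D \<Longrightarrow> finite (B z)" "\<And>z. z \<in> D \<Longrightarrow> B z \<subseteq> generalized_eigenspace T z"
      "\<And>z. z \<in> D \<Longrightarrow> complex_vector.independent (B z)"
      "\<And>z. z \<in> D \<Longrightarrow> generalized_eigenspace T z \<subseteq> cspan (B z)"
      "\<And>z. z \<in> D \<Longrightarrow> card (B z) = alg_mult T z"
    by metis
  define I where "I = Sigma D B"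
  have finI: "finite I" using B(1) \<open>finite D\<close> by (simp add: I_def)
  have cardI: "card I = (\<Sum>z\<in>D. alg_mult T z)" using B(1,5) \<open>finite D\<close> by (simp add: I_def)
  have split: "(\<Sum>i\<in>I. f i *\<^sub>C snd i) = (\<Sum>z\<in>D. \<Sum>v\<in>B z. f (z, v) *\<^sub>C v)" for f
    unfolding I_def using B(1) \<open>finite D\<close> by (subst sum.Sigma) (auto simp: case_prod_unfold)
  have inG: "(\<Sum>v\<in>B z. g v *\<^sub>C v) \<in> generalized_eigenspace T z" if "z \<in> D" for z g
    using B(2)[OF that] subspace_generalized_eigenspace[OF T]
    by (intro complex_vector.subspace_sum complex_vector.subspace_scale) auto
  have ind: "\<forall>i\<in>I. f i = 0" if "(\<Sum>i\<in>I. f i *\<^sub>C snd i) = 0" for f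
  proof -
    have "\<forall>z\<in>D. (\<Sum>v\<in>B z. f (z, v) *\<^sub>C v) = 0"
      using that split by (intro generalized_eigenspaces_independent[OF T \<open>finite D\<close>] inG) auto
    then show ?thesis
      using complex_vector.independentD[OF B(3) B(1)] unfolding I_def by fastforce
  qed
  obtain c0 where c0: "c0 > 0"
    "\<And>f j. j \<in> I \<Longrightarrow> c0 * cmod (f j) \<le> norm (\<Sum>i\<in>I. f i *\<^sub>C snd i)"
    using coefficient_bound_of_independent_family[OF finI ind] by blast
  define C where "C = (\<Sum>i\<in>I. norm (snd i)) / c0"
  have C: "C \<ge> 0" using c0(1) by (simp add: C_def sum_nonneg)
  \<comment> \<open>Coordinate projections onto the single generalized eigenspaces are bounded by \<open>C\<close>.\<close>
  have comp: "norm (x z) \<le> C * norm (\<Sum>z\<in>D. x z)"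
    if z: "z \<in> D" and x: "\<And>z. z \<in> D \<Longrightarrow> x z \<in> generalized_eigenspace T z" for x z
  proof -
    have "\<exists>u. x z = (\<Sum>v\<in>B z. u v *\<^sub>C v)" if "z \<in> D" for z
      using x[OF that] B(4)[OF that] complex_vector.span_finite[OF B(1)[OF that]] by auto
    then obtain u where u: "\<And>z. z \<in> D \<Longrightarrow> x z = (\<Sum>v\<in>B z. u z v *\<^sub>C v)" by metis
    have sum: "(\<Sum>z\<in>D. x z) = (\<Sum>i\<in>I. u (fst i) (snd i) *\<^sub>C snd i)" (is "_ = ?X")
      using split[of "\<lambda>i. u (fst i) (snd i)"] u by simp
    have "c0 * norm (x z) \<le> (\<Sum>v\<in>B z. c0 * (cmod (u z v) * norm v))"
      unfolding u[OF z] sum_distrib_left[symmetric] using c0(1)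
      by (intro mult_left_mono order_trans[OF norm_sum]) (auto simp: norm_scaleC)
    also have "\<dots> \<le> (\<Sum>v\<in>B z. norm ?X * norm v)"
    proof (rule sum_mono)
      fix v assume "v \<in> B z"
      then have "c0 * cmod (u z v) \<le> norm ?X"
        using c0(2)[of "(z, v)" "\<lambda>i. u (fst i) (snd i)"] z by (simp add: I_def)
      then show "c0 * (cmod (u z v) * norm v) \<le> norm ?X * norm v"
        by (metis mult.assoc mult_right_mono norm_ge_zero)
    qed
    also have "\<dots> = norm ?X * (\<Sum>v\<in>B z. norm v)" by (simp add: sum_distrib_left)
    also have "(\<Sum>v\<in>B z. norm v) = (\<Sum>i\<in>{z} \<times> B z. norm (snd i))"
      by (rule sum.reindex_bij_witness[of _ snd "Pair z"]) auto
    also have "\<dots> \<le> (\<Sum>i\<in>I. norm (snd i))"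
      using z finI by (intro sum_mono2) (auto simp: I_def)
    finally have "c0 * norm (x z) \<le> norm ?X * (\<Sum>i\<in>I. norm (snd i))"
      by (simp add: mult_left_mono)
    then show ?thesis using c0(1) by (simp add: C_def sum field_simps)
  qed
  have "\<exists>c>0. \<forall>x\<in>generalized_eigenspace T z. \<forall>k. c * s ^ k * norm x \<le> norm ((T ^^ k) x)"
    if z: "z \<in> D" for z
  proof -
    obtain m where "\<And>x. x \<in> cspan (B z) \<Longrightarrow> ((\<lambda>y. z *\<^sub>C y - T y) ^^ m) x = 0"
      using finite_generalized_eigenspace_exponent[OF T B(1)[OF z] B(2)[OF z]] by blast
    then show ?thesis
      using iterates_expand_on_kernel_of_power[OF T s, of z m] D[OF z] B(4)[OF z] by (metis subsetD)
  qed
  then obtain d where d: "\<And>z. z \<in> D \<Longrightarrow> d z > 0"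
    "\<And>z x k. z \<in> D \<Longrightarrow> x \<in> generalized_eigenspace T z \<Longrightarrow> d z * s ^ k * norm x \<le> norm ((T ^^ k) x)"
    by metis
  define E where "E = (\<Sum>z\<in>D. C / d z) + 1"
  have E: "E > 0"
    unfolding E_def using C d(1) by (intro add_nonneg_pos sum_nonneg divide_nonneg_nonneg) (auto simp: less_imp_le)
  have low: "1 / E * s ^ k * norm (\<Sum>i\<in>I. f i *\<^sub>C snd i) \<le> norm ((T ^^ k) (\<Sum>i\<in>I. f i *\<^sub>C snd i))"
    for f k
  proof -
    define x where "x z = (\<Sum>v\<in>B z. f (z, v) *\<^sub>C v)" for z
    have X: "(\<Sum>i\<in>I. f i *\<^sub>C snd i) = (\<Sum>z\<in>D. x z)" using split by (simp add: x_def)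
    have Tk: "bounded_clinear (T ^^ k)" by (rule bounded_clinear_funpow[OF T])
    have TX: "(T ^^ k) (\<Sum>z\<in>D. x z) = (\<Sum>z\<in>D. (T ^^ k) (x z))" by (rule clinear_sum[OF Tk])
    have xG: "x z \<in> generalized_eigenspace T z" if "z \<in> D" for z using inG[OF that] by (simp add: x_def)
    have TxG: "(T ^^ k) (x z) \<in> generalized_eigenspace T z" if "z \<in> D" for z
      by (rule generalized_eigenspace_invariant[OF T Tk _ xG[OF that]]) (simp add: funpow_swap1)
    have each: "s ^ k * norm (x z) \<le> C / d z * norm ((T ^^ k) (\<Sum>z\<in>D. x z))" if z: "z \<in> D" for z
    proof -
      have "d z * s ^ k * norm (x z) \<le> C * norm ((T ^^ k) (\<Sum>z\<in>D. x z))"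
        using d(2)[OF z xG[OF z], of k] comp[of z "\<lambda>z. (T ^^ k) (x z)", OF z TxG] TX by simp
      then show ?thesis using d(1)[OF z] by (simp add: field_simps)
    qed
    have "s ^ k * norm (\<Sum>z\<in>D. x z) \<le> (\<Sum>z\<in>D. s ^ k * norm (x z))"
      unfolding sum_distrib_left[symmetric] using s by (intro mult_left_mono norm_sum) auto
    also have "\<dots> \<le> (\<Sum>z\<in>D. C / d z * norm ((T ^^ k) (\<Sum>z\<in>D. x z)))"
      by (intro sum_mono each)
    also have "\<dots> = (E - 1) * norm ((T ^^ k) (\<Sum>z\<in>D. x z))"
      by (simp add: E_def sum_distrib_right)
    also have "\<dots> \<le> E * norm ((T ^^ k) (\<Sum>z\<in>D. x z))" by (simp add: mult_right_mono)
    finally show ?thesis unfolding X using E by (simp add: field_simps)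
  qed
  show ?thesis by (rule that[OF _ finI cardI ind low]) (use E in auto)
qed


section \<open>Volume comparison by counting\<close>

text \<open>The images under \<open>T\<close> of balls of radius \<open>\<rho>\<^sup>k\<close> are translates of scaled copies of the
  image of the unit ball, so one cover of the latter serves for all of them.\<close>

lemma cover_of_iterate:
  fixes T :: "'a::complex_banach \<Rightarrow> 'a"
  assumes T: "bounded_clinear T" and \<rho>: "\<rho> > 0" and Y: "finite Y"
    and cov: "T ` cball 0 1 \<subseteq> (\<Union>y\<in>Y. cball y \<rho>)"
  shows "\<exists>Z. finite Z \<and> card Z \<le> card Y ^ k \<and> (T ^^ k) ` cball 0 1 \<subseteq> (\<Union>y\<in>Z. cball y (\<rho> ^ k))"
proof (induction k)
  case 0
  show ?case by (intro exI[of _ "{0}"]) auto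
next
  case (Suc k)
  then obtain Z where Z: "finite Z" "card Z \<le> card Y ^ k"
    "(T ^^ k) ` cball 0 1 \<subseteq> (\<Union>y\<in>Z. cball y (\<rho> ^ k))" by blast
  define W where "W = (\<lambda>(z, y). T z + \<rho> ^ k *\<^sub>R y) ` (Z \<times> Y)"
  have "card W \<le> card Z * card Y"
    unfolding W_def using card_image_le[of "Z \<times> Y"] Z(1) Y by (simp add: card_cartesian_product)
  also have "\<dots> \<le> card Y ^ Suc k" using Z(2) by simp
  finally have "card W \<le> card Y ^ Suc k" .
  moreover have "(T ^^ Suc k) ` cball 0 1 \<subseteq> (\<Union>y\<in>W. cball y (\<rho> ^ Suc k))"
  proof
    fix v assume "v \<in> (T ^^ Suc k) ` cball 0 1"
    then obtain x where x: "x \<in> cball 0 1" "v = T ((T ^^ k) x)" by auto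
    then obtain z where z: "z \<in> Z" "norm ((T ^^ k) x - z) \<le> \<rho> ^ k"
      using Z(3) by (force simp: dist_norm norm_minus_commute)
    define u where "u = (1 / \<rho> ^ k) *\<^sub>R ((T ^^ k) x - z)"
    have "norm u = norm ((T ^^ k) x - z) / \<rho> ^ k" using \<rho> by (simp add: u_def)
    then have "u \<in> cball 0 1" using z(2) \<rho> by (simp add: divide_le_eq)
    then obtain y where y: "y \<in> Y" "norm (T u - y) \<le> \<rho>"
      using cov by (force simp: dist_norm norm_minus_commute)
    have "(T ^^ k) x = z + \<rho> ^ k *\<^sub>R u" using \<rho> by (simp add: u_def)
    then have "v = T z + \<rho> ^ k *\<^sub>R T u"
      using x(2) by (simp add: clinear_add[OF T]
          linear_scale[OF bounded_linear.linear[OF bounded_clinear_imp_bounded_linear[OF T]]])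
    then have "v - (T z + \<rho> ^ k *\<^sub>R y) = \<rho> ^ k *\<^sub>R (T u - y)" by (simp add: algebra_simps)
    then have "norm (v - (T z + \<rho> ^ k *\<^sub>R y)) \<le> \<rho> ^ k * \<rho>"
      using y(2) \<rho> by (simp add: mult_left_mono)
    then have "v \<in> cball (T z + \<rho> ^ k *\<^sub>R y) (\<rho> ^ Suc k)"
      by (simp add: dist_norm norm_minus_commute mult.commute)
    then show "v \<in> (\<Union>y\<in>W. cball y (\<rho> ^ Suc k))" using z(1) y(1) unfolding W_def by force
  qed
  moreover have "finite W" using Z(1) Y by (simp add: W_def)
  ultimately show ?case by blast
qed

text \<open>A grid of \<open>m\<^sup>2\<close> points in each complex coordinate replaces Lebesgue measure on the
  span: at mesh proportional to \<open>1 / m\<close> the grid lies in the unit ball, and its points stay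
  so far apart under \<open>S\<close> that no ball of the cover contains two of their images.\<close>

lemma grid_card_le_cover_card:
  fixes S :: "'a::complex_banach \<Rightarrow> 'a" and b :: "'i \<Rightarrow> 'a" and m :: nat
  assumes S: "bounded_clinear S" and fin: "finite I"
    and c: "c > 0" "\<And>f j. j \<in> I \<Longrightarrow> c * cmod (f j) \<le> norm (\<Sum>i\<in>I. f i *\<^sub>C b i)"
    and low: "\<And>f. \<mu> * norm (\<Sum>i\<in>I. f i *\<^sub>C b i) \<le> norm (S (\<Sum>i\<in>I. f i *\<^sub>C b i))"
    and \<mu>: "\<mu> \<ge> 0"
    and Z: "finite Z" "S ` cball 0 1 \<subseteq> (\<Union>y\<in>Z. cball y r)"
    and m: "m > 0" "2 * r * m * (2 * (\<Sum>i\<in>I. norm (b i)) + 1) < c * \<mu>"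
  shows "m ^ (2 * card I) \<le> card Z"
proof -
  \<comment> \<open>The factor two bounds the modulus of a sum of a real and an imaginary part, and the
    additional one keeps \<open>M\<close> positive when all vectors vanish or \<open>I\<close> is empty.\<close>
  define M where "M = 2 * (\<Sum>i\<in>I. norm (b i)) + 1"
  have M: "M > 0" unfolding M_def by (intro add_nonneg_pos mult_nonneg_nonneg sum_nonneg) auto
  define Q where "Q = (\<Pi>\<^sub>E i\<in>I. {..<m} \<times> {..<m})"
  define q where "q p = Complex (real (fst p)) (real (snd p))" for p :: "nat \<times> nat"
  define x where "x f = (\<Sum>i\<in>I. (of_real (1 / (m * M)) * q (f i)) *\<^sub>C b i)" for f :: "'i \<Rightarrow> nat \<times> nat"
  have cardQ: "card Q = m ^ (2 * card I)"
    using fin by (simp add: Q_def card_PiE card_cartesian_product power_mult power2_eq_square)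
  have ball: "x f \<in> cball 0 1" if "f \<in> Q" for f
  proof -
    have "norm (x f) \<le> (\<Sum>i\<in>I. 1 / (m * M) * (2 * m) * norm (b i))"
      unfolding x_def
    proof (rule order_trans[OF norm_sum sum_mono])
      fix i assume "i \<in> I"
      then have "fst (f i) < m" "snd (f i) < m"
        using that by (auto simp: Q_def PiE_def Pi_def mem_Times_iff)
      then have "cmod (q (f i)) \<le> 2 * m"
        using cmod_le[of "q (f i)"] by (simp add: q_def)
      then have "1 / (m * M) * cmod (q (f i)) * norm (b i) \<le> 1 / (m * M) * (2 * m) * norm (b i)"
        using M by (intro mult_right_mono mult_left_mono) auto
      then show "norm ((of_real (1 / (m * M)) * q (f i)) *\<^sub>C b i) \<le> 1 / (m * M) * (2 * m) * norm (b i)"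
        using M by (simp add: norm_scaleC norm_mult norm_divide)
    qed
    also have "\<dots> = 2 * (\<Sum>i\<in>I. norm (b i)) / M"
      using m(1) by (simp add: sum_distrib_left sum_divide_distrib field_simps)
    also have "\<dots> \<le> 1" using M by (simp add: M_def)
    finally show ?thesis by simp
  qed
  have sep: "2 * r < norm (S (x f) - S (x g))" if fg: "f \<in> Q" "g \<in> Q" "f \<noteq> g" for f g
  proof -
    obtain j where j: "j \<in> I" "f j \<noteq> g j"
      using fg unfolding Q_def by (meson PiE_ext)
    define h where "h i = of_real (1 / (m * M)) * (q (f i) - q (g i))" for i
    have diff: "x f - x g = (\<Sum>i\<in>I. h i *\<^sub>C b i)"
      unfolding x_def h_def sum_subtractf[symmetric]
      by (simp add: complex_vector.scale_left_diff_distrib[symmetric] right_diff_distrib[symmetric]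
          diff_divide_distrib)
    have "1 \<le> cmod (q (f j) - q (g j))"
    proof -
      have "1 \<le> \<bar>real (fst (f j)) - real (fst (g j))\<bar> \<or> 1 \<le> \<bar>real (snd (f j)) - real (snd (g j))\<bar>"
      proof -
        have "fst (f j) \<noteq> fst (g j) \<or> snd (f j) \<noteq> snd (g j)" using j(2) by (auto simp: prod_eq_iff)
        then show ?thesis by linarith
      qed
      then show ?thesis
        using abs_Re_le_cmod[of "q (f j) - q (g j)"] abs_Im_le_cmod[of "q (f j) - q (g j)"]
        by (auto simp: q_def)
    qed
    then have "1 / (m * M) \<le> cmod (h j)"
      using M m(1) by (simp add: h_def norm_mult norm_divide divide_right_mono)
    then have "c * (1 / (m * M)) \<le> c * cmod (h j)" using c(1) by (intro mult_left_mono) auto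
    also have "\<dots> \<le> norm (x f - x g)" unfolding diff by (rule c(2)[OF j(1)])
    finally have "c * (1 / (m * M)) \<le> norm (x f - x g)" .
    then have "\<mu> * (c * (1 / (m * M))) \<le> \<mu> * norm (x f - x g)" using \<mu> by (rule mult_left_mono)
    also have "\<dots> \<le> norm (S (x f) - S (x g))"
      unfolding clinear_diff[OF S, symmetric] diff by (rule low)
    finally have "\<mu> * (c * (1 / (m * M))) \<le> norm (S (x f) - S (x g))" .
    moreover have "2 * r < \<mu> * (c * (1 / (m * M)))"
    proof -
      have "2 * r * (m * M) < \<mu> * c" using m(2) by (simp only: M_def mult_ac)
      then show ?thesis using m(1) M by (simp add: pos_less_divide_eq)
    qed
    ultimately show ?thesis by linarith
  qed
  have "\<exists>y\<in>Z. S (x f) \<in> cball y r" if "f \<in> Q" for f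
    using Z(2) ball[OF that] by blast
  then obtain y where y: "\<And>f. f \<in> Q \<Longrightarrow> y f \<in> Z" "\<And>f. f \<in> Q \<Longrightarrow> S (x f) \<in> cball (y f) r"
    by metis
  have "inj_on y Q"
  proof (rule inj_onI, rule ccontr)
    fix f g assume fg: "f \<in> Q" "g \<in> Q" "y f = y g" "f \<noteq> g"
    have "dist (S (x f)) (S (x g)) \<le> dist (S (x f)) (y f) + dist (y f) (S (x g))"
      by (rule dist_triangle)
    also have "\<dots> \<le> r + r" using y(2)[OF fg(1)] y(2)[OF fg(2)] fg(3) by (simp add: dist_commute)
    finally show False using sep[OF fg(1,2,4)] by (simp add: dist_norm)
  qed
  then have "card Q \<le> card Z" using y(1) Z(1) by (intro card_inj_on_le[of y]) auto
  then show ?thesis using cardQ by simp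
qed

text \<open>Applied to \<open>T\<close> itself the counting argument loses a constant factor. Applied to
  \<open>T\<^sup>k\<close>, which needs at most the \<open>k\<close>-th power of the number of balls, with radius \<open>\<rho>\<^sup>k\<close>, the
  loss is still a constant and disappears in the limit of \<open>k\<close>-th roots.\<close>

lemma expansion_le_cover:
  fixes T :: "'a::complex_banach \<Rightarrow> 'a" and b :: "'i \<Rightarrow> 'a" and s \<rho> :: real
  assumes T: "bounded_clinear T" and fin: "finite I" and s: "s > 0" and d: "d > 0"
    and ind: "\<And>f. (\<Sum>i\<in>I. f i *\<^sub>C b i) = 0 \<Longrightarrow> \<forall>i\<in>I. f i = 0"
    and low: "\<And>f k. d * s ^ k * norm (\<Sum>i\<in>I. f i *\<^sub>C b i) \<le> norm ((T ^^ k) (\<Sum>i\<in>I. f i *\<^sub>C b i))"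
    and \<rho>: "\<rho> > 0" and Y: "finite Y" "T ` cball 0 1 \<subseteq> (\<Union>y\<in>Y. cball y \<rho>)"
  shows "s ^ (2 * card I) \<le> card Y * \<rho> ^ (2 * card I)"
proof -
  define n where "n = 2 * card I"
  define \<theta> where "\<theta> = s / \<rho>"
  have \<theta>: "\<theta> > 0" using s \<rho> by (simp add: \<theta>_def)
  have "Y \<noteq> {}" using Y(2) by (metis UN_empty cball_eq_empty image_is_empty not_one_less_zero subset_empty)
  then have Y1: "card Y \<ge> 1" using Y(1) by (simp add: Suc_leI card_gt_0_iff)
  have "\<theta> ^ n \<le> card Y"
  proof (cases "\<theta> \<le> 1")
    case True
    then have "\<theta> ^ n \<le> 1" using \<theta> by (simp add: power_le_one)
    then show ?thesis using Y1 by linarith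
  next
    case False
    obtain c where c: "c > 0" "\<And>f j. j \<in> I \<Longrightarrow> c * cmod (f j) \<le> norm (\<Sum>i\<in>I. f i *\<^sub>C b i)"
      using coefficient_bound_of_independent_family[OF fin ind] by blast
    define M where "M = 2 * (\<Sum>i\<in>I. norm (b i)) + 1"
    have M: "M > 0" unfolding M_def by (intro add_nonneg_pos mult_nonneg_nonneg sum_nonneg) auto
    \<comment> \<open>Half of the largest admissible \<open>\<kappa>\<close>, since the separation of the grid has to be strict.\<close>
    define \<kappa> where "\<kappa> = c * d / (4 * M)"
    have \<kappa>: "\<kappa> > 0" using c d M by (simp add: \<kappa>_def)
    have step: "(\<kappa> / 2 * \<theta> ^ k) ^ n \<le> real (card Y) ^ k" if k: "\<kappa> * \<theta> ^ k \<ge> 2" for k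
    proof -
      define m where "m = nat \<lfloor>\<kappa> * \<theta> ^ k\<rfloor>"
      have m: "real m \<le> \<kappa> * \<theta> ^ k" "\<kappa> / 2 * \<theta> ^ k \<le> real m" "m > 0"
        using k unfolding m_def by linarith+
      have "2 * \<rho> ^ k * real m * M \<le> 2 * \<rho> ^ k * (\<kappa> * \<theta> ^ k) * M"
        using m(1) \<rho> M by (intro mult_left_mono mult_right_mono) auto
      also have "\<dots> = c * (d * s ^ k) / 2"
        using \<rho> M by (simp add: \<kappa>_def \<theta>_def power_divide)
      also have "\<dots> < c * (d * s ^ k)" using c(1) d s by simp
      finally have sm: "2 * \<rho> ^ k * real m * M < c * (d * s ^ k)" .
      obtain Z where Z: "finite Z" "card Z \<le> card Y ^ k"
        "(T ^^ k) ` cball 0 1 \<subseteq> (\<Union>y\<in>Z. cball y (\<rho> ^ k))"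
        using cover_of_iterate[OF T \<rho> Y, of k] by blast
      have "m ^ n \<le> card Z"
        unfolding n_def using s d
        by (intro grid_card_le_cover_card[OF bounded_clinear_funpow[OF T] fin c low _ Z(1,3) m(3)])
          (use sm in \<open>auto simp: M_def mult_ac\<close>)
      then have "m ^ n \<le> card Y ^ k" using Z(2) by linarith
      then have "real m ^ n \<le> real (card Y) ^ k" by (metis of_nat_le_iff of_nat_power)
      moreover have "(\<kappa> / 2 * \<theta> ^ k) ^ n \<le> real m ^ n"
        using m(2) \<kappa> \<theta> by (intro power_mono) auto
      ultimately show ?thesis by linarith
    qed
    show ?thesis
    proof (rule ccontr)
      assume "\<not> \<theta> ^ n \<le> card Y"
      then have "\<theta> ^ n / card Y > 1" using Y1 by (simp add: field_simps)
      then obtain k\<^sub>1 where k\<^sub>1: "1 / (\<kappa> / 2) ^ n < (\<theta> ^ n / card Y) ^ k\<^sub>1"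
        using real_arch_pow by blast
      obtain k\<^sub>2 where k\<^sub>2: "2 / \<kappa> < \<theta> ^ k\<^sub>2"
        using real_arch_pow False by (meson not_le)
      define k where "k = max k\<^sub>1 k\<^sub>2"
      have "(\<theta> ^ n / card Y) ^ k\<^sub>1 \<le> (\<theta> ^ n / card Y) ^ k" "\<theta> ^ k\<^sub>2 \<le> \<theta> ^ k"
        using \<open>\<theta> ^ n / card Y > 1\<close> False unfolding k_def by (intro power_increasing; simp)+
      then have k: "1 / (\<kappa> / 2) ^ n < (\<theta> ^ n / card Y) ^ k" "2 / \<kappa> \<le> \<theta> ^ k"
        using k\<^sub>1 k\<^sub>2 by linarith+
      have "(\<kappa> / 2) ^ n * (\<theta> ^ n) ^ k \<le> real (card Y) ^ k"
        using step[of k] k(2) \<kappa> by (simp add: field_simps power_mult_distrib power_commutes flip: power_mult)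
      moreover have "0 < real (card Y) ^ k" using Y1 by simp
      ultimately have "(\<kappa> / 2) ^ n * (\<theta> ^ n) ^ k / real (card Y) ^ k \<le> 1"
        by (simp only: divide_le_eq_1_pos)
      then have "(\<kappa> / 2) ^ n * (\<theta> ^ n / card Y) ^ k \<le> 1"
        by (simp only: power_divide[of "\<theta> ^ n"] times_divide_eq_right)
      moreover have "0 < (\<kappa> / 2) ^ n" using \<kappa> by simp
      ultimately have "(\<theta> ^ n / card Y) ^ k \<le> 1 / (\<kappa> / 2) ^ n"
        by (simp only: pos_le_divide_eq mult.commute)
      then show False using k(1) by linarith
    qed
  qed
  then show ?thesis using \<rho> by (simp add: \<theta>_def n_def power_divide field_simps)
qed


section \<open>Covers from entropy numbers\<close>

lemma entropy_radii_nonempty: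
  assumes K: "bounded_clinear K"
  shows "\<exists>\<epsilon>>0. \<exists>Y. finite Y \<and> card Y \<le> 2 ^ (n - 1) \<and> K ` cball 0 1 \<subseteq> (\<Union>y\<in>Y. cball y \<epsilon>)"
proof -
  have bl: "bounded_linear K" using K by (rule bounded_clinear_imp_bounded_linear)
  have "norm (K x) \<le> onorm K + 1" if "norm x \<le> 1" for x
    using onorm[OF bl, of x] mult_left_mono[OF that onorm_pos_le[OF bl]] by simp
  then have "K ` cball 0 1 \<subseteq> cball 0 (onorm K + 1)" by auto
  moreover have "onorm K + 1 > 0" using onorm_pos_le[OF bl] by simp
  ultimately show ?thesis by (intro exI[of _ "onorm K + 1"] conjI exI[of _ "{0}"]) auto
qed

lemma entropy_number_nonneg:
  assumes "bounded_clinear K"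
  shows "entropy_number n K \<ge> 0"
  unfolding entropy_number_def using entropy_radii_nonempty[OF assms, of n]
  by (intro cInf_greatest) auto

lemma cover_of_entropy_number_less:
  assumes K: "bounded_clinear K" and e: "entropy_number n K < \<epsilon>"
  shows "\<exists>Y. finite Y \<and> card Y \<le> 2 ^ (n - 1) \<and> K ` cball 0 1 \<subseteq> (\<Union>y\<in>Y. cball y \<epsilon>)"
proof -
  let ?R = "{\<delta>. \<delta> > 0 \<and> (\<exists>Y. finite Y \<and> card Y \<le> 2 ^ (n - 1) \<and> K ` cball 0 1 \<subseteq> (\<Union>y\<in>Y. cball y \<delta>))}"
  have "?R \<noteq> {}" using entropy_radii_nonempty[OF K, of n]
    by (subst ex_in_conv[symmetric]) (simp only: mem_Collect_eq)
  then have "\<exists>\<delta>\<in>?R. \<delta> < \<epsilon>" using e unfolding entropy_number_def by (rule cInf_lessD)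
  then obtain \<delta> Y where Y: "\<delta> < \<epsilon>" "finite Y" "card Y \<le> 2 ^ (n - 1)"
    "K ` cball 0 1 \<subseteq> (\<Union>y\<in>Y. cball y \<delta>)"
    by (elim bexE) (simp only: mem_Collect_eq, elim conjE exE, rule that)
  then have "(\<Union>y\<in>Y. cball y \<delta>) \<subseteq> (\<Union>y\<in>Y. cball y \<epsilon>)" by (intro UN_mono subset_cball) auto
  then have "K ` cball 0 1 \<subseteq> (\<Union>y\<in>Y. cball y \<epsilon>)" by (rule subset_trans[OF Y(4)])
  then show ?thesis using Y(2,3) by (intro exI conjI)
qed

text \<open>This is the inequality \<open>e\<^sub>n (A + K) \<le> \<parallel>A\<parallel> + e\<^sub>n (K)\<close> at the level of covers:
  the images under \<open>A\<close> only enlarge the balls and require no further centres.\<close>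

lemma cover_of_perturbation:
  assumes A: "bounded_clinear A"
    and cov: "K ` cball 0 1 \<subseteq> (\<Union>y\<in>Y. cball y \<epsilon>)"
  shows "(\<lambda>x. A x + K x) ` cball 0 1 \<subseteq> (\<Union>y\<in>Y. cball y (onorm A + \<epsilon>))"
proof
  fix v assume "v \<in> (\<lambda>x. A x + K x) ` cball 0 1"
  then obtain x where x: "norm x \<le> 1" "v = A x + K x" by auto
  then obtain y where y: "y \<in> Y" "norm (K x - y) \<le> \<epsilon>"
    using cov by (force simp: dist_norm norm_minus_commute)
  have bl: "bounded_linear A" using A by (rule bounded_clinear_imp_bounded_linear)
  have "norm (A x) \<le> onorm A"
    using onorm[OF bl, of x] mult_left_mono[OF x(1) onorm_pos_le[OF bl]] by simp
  then have "norm (v - y) \<le> onorm A + \<epsilon>"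
    using y(2) norm_triangle_ineq[of "A x" "K x - y"] by (simp add: x(2) add_diff_eq)
  then show "v \<in> (\<Union>y\<in>Y. cball y (onorm A + \<epsilon>))"
    using y(1) by (auto simp: dist_norm norm_minus_commute)
qed

lemma entropy_number_le_quasinorm:
  assumes "K \<in> entropy_class p" "n \<ge> 1"
  shows "real n powr (1 / p) * entropy_number n K \<le> entropy_quasinorm p K"
  using assms unfolding entropy_class_def entropy_quasinorm_def by (intro cSUP_upper) auto


section \<open>Counting eigenvalues\<close>

lemma multiplicity_power_le_cover:
  fixes T :: "'a::complex_banach \<Rightarrow> 'a" and s \<rho> :: real
  assumes T: "bounded_clinear T" and "finite D" "s > 0"
    and D: "\<And>z. z \<in> D \<Longrightarrow> s < cmod z \<and> finite_alg_mult T z"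
    and "\<rho> > 0" "finite Y" "T ` cball 0 1 \<subseteq> (\<Union>y\<in>Y. cball y \<rho>)"
  shows "s ^ (2 * (\<Sum>z\<in>D. alg_mult T z)) \<le> card Y * \<rho> ^ (2 * (\<Sum>z\<in>D. alg_mult T z))"
proof -
  obtain c and I :: "(complex \<times> 'a) set" where I: "c > 0" "finite I" "card I = (\<Sum>z\<in>D. alg_mult T z)"
    "\<And>f. (\<Sum>i\<in>I. f i *\<^sub>C snd i) = 0 \<Longrightarrow> \<forall>i\<in>I. f i = 0"
    "\<And>f k. c * s ^ k * norm (\<Sum>i\<in>I. f i *\<^sub>C snd i) \<le> norm ((T ^^ k) (\<Sum>i\<in>I. f i *\<^sub>C snd i))"
    by (rule expanding_family_of_generalized_eigenvectors[OF T assms(2,3) D]) (assumption | rule that)+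
  show ?thesis
    using expansion_le_cover[OF T I(2) assms(3) I(1,4,5) assms(5-7)] I(3) by simp
qed

text \<open>With \<open>N\<close> the total multiplicity, the index \<open>n\<close> is chosen with
  \<open>n - 1 \<le> 2 * N * t / ln 2 < n\<close>: the first inequality turns the number \<open>2 ^ (n - 1)\<close> of balls into
  the factor \<open>exp t\<close> after extraction of the \<open>2 N\<close>-th root, the second one makes the
  \<open>n\<close>-th entropy number small.\<close>

lemma total_multiplicity_le:
  fixes A K :: "'a::complex_banach \<Rightarrow> 'a" and D :: "complex set"
  defines "T \<equiv> \<lambda>x. A x + K x"
  assumes A: "bounded_clinear A" and p: "p > 0" and K: "K \<in> entropy_class p"
    and D: "finite D" "\<And>z. z \<in> D \<Longrightarrow> s < cmod z \<and> finite_alg_mult T z"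
    and s: "s > 0" and t: "t > 0" "s * exp (- t) > onorm A"
  shows "real (\<Sum>z\<in>D. alg_mult T z)
    \<le> ln 2 / 2 * (1 / (t * (s * exp (- t) - onorm A) powr p)) * entropy_quasinorm p K powr p"
proof (cases "(\<Sum>z\<in>D. alg_mult T z) = 0")
  case True
  then show ?thesis using t(1) by (simp only: True) simp
next
  case False
  define N where "N = (\<Sum>z\<in>D. alg_mult T z)"
  define a where "a = onorm A"
  define u where "u = s * exp (- t) - a"
  define n where "n = nat \<lfloor>2 * N * t / ln 2\<rfloor> + 1"
  have Kc: "bounded_clinear K" using K by (simp add: entropy_class_def)
  have T: "bounded_clinear T" unfolding T_def by (rule bounded_clinear_add[OF A Kc])
  have a: "a \<ge> 0" unfolding a_def by (intro onorm_pos_le bounded_clinear_imp_bounded_linear A)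
  have u: "u > 0" using t(2) by (simp add: u_def a_def)
  have N: "N > 0" using False by (simp add: N_def)
  have "0 \<le> 2 * N * t / ln 2" using t(1) by simp
  then have n: "real (n - 1) \<le> 2 * N * t / ln 2" "2 * N * t / ln 2 < n" "n \<ge> 1"
    unfolding n_def by linarith+
  have "u \<le> \<epsilon>" if e: "entropy_number n K < \<epsilon>" for \<epsilon>
  proof -
    have \<epsilon>: "\<epsilon> > 0" using e entropy_number_nonneg[OF Kc, of n] by linarith
    obtain Y where Y: "finite Y" "card Y \<le> 2 ^ (n - 1)" "K ` cball 0 1 \<subseteq> (\<Union>y\<in>Y. cball y \<epsilon>)"
      using cover_of_entropy_number_less[OF Kc e] by blast
    have "s ^ (2 * N) \<le> card Y * (a + \<epsilon>) ^ (2 * N)"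
      unfolding N_def
      by (rule multiplicity_power_le_cover[OF T D(1) s D(2) _ Y(1)])
        (use a \<epsilon> cover_of_perturbation[OF A Y(3)] in \<open>auto simp: a_def T_def\<close>)
    also have "\<dots> \<le> 2 ^ (n - 1) * (a + \<epsilon>) ^ (2 * N)"
    proof (rule mult_right_mono)
      show "real (card Y) \<le> 2 ^ (n - 1)" using Y(2) by (metis of_nat_le_iff of_nat_numeral of_nat_power)
    qed (use a \<epsilon> in auto)
    also have "(2::real) ^ (n - 1) = exp (real (n - 1) * ln 2)"
      by (simp add: exp_of_nat_mult)
    also have "\<dots> \<le> exp (2 * N * t)"
      using n(1) by (simp add: pos_le_divide_eq)
    also have "exp (2 * N * t) = exp t ^ (2 * N)"
      by (simp add: exp_of_nat_mult[symmetric])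
    finally have "s ^ (2 * N) \<le> (exp t * (a + \<epsilon>)) ^ (2 * N)"
      using a \<epsilon> by (simp add: power_mult_distrib mult_right_mono)
    then have "s \<le> exp t * (a + \<epsilon>)"
      using N a \<epsilon> by (intro power_le_imp_le_base[of s "2 * N - 1"]) (auto simp: Suc_diff_1)
    then have "s * exp (- t) \<le> a + \<epsilon>" by (simp add: exp_minus field_simps)
    then show ?thesis by (simp add: u_def)
  qed
  then have "u \<le> entropy_number n K" by (rule dense_ge)
  then have "real n powr (1 / p) * u \<le> entropy_quasinorm p K"
    using entropy_number_le_quasinorm[OF K n(3)] by (meson mult_left_mono order_trans powr_ge_zero)
  then have "(real n powr (1 / p) * u) powr p \<le> entropy_quasinorm p K powr p"
    using u p by (intro powr_mono2) auto
  also have "(real n powr (1 / p) * u) powr p = real n * u powr p"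
    using u p by (simp add: powr_mult powr_powr)
  finally have "real n * u powr p \<le> entropy_quasinorm p K powr p" .
  moreover have "2 * N * t / ln 2 * u powr p \<le> real n * u powr p"
    using n(2) by (intro mult_right_mono) auto
  ultimately have "2 * N * t / ln 2 * u powr p \<le> entropy_quasinorm p K powr p" by linarith
  then have "real N * (t * u powr p) \<le> ln 2 / 2 * entropy_quasinorm p K powr p"
    by (simp add: field_simps)
  then have "real N \<le> (ln 2 / 2 * entropy_quasinorm p K powr p) / (t * u powr p)"
    using u t(1) by (simp add: pos_le_divide_eq)
  then show ?thesis by (simp add: N_def u_def a_def mult_ac)
qed

lemma alg_mult_pos:
  assumes "eigenvalue T z" "finite_alg_mult T z"
  shows "alg_mult T z \<ge> 1"
proof -
  obtain x where x: "x \<noteq> 0" "T x = z *\<^sub>C x" using assms(1) by (auto simp: eigenvalue_def)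
  then have "x \<in> generalized_eigenspace T z"
    by (auto simp: generalized_eigenspace_def intro!: exI[of _ 1])
  moreover obtain F where F: "finite F" "generalized_eigenspace T z \<subseteq> cspan F"
    using assms(2) by (auto simp: finite_alg_mult_def)
  moreover obtain B where B: "B \<subseteq> generalized_eigenspace T z" "complex_vector.independent B"
      "generalized_eigenspace T z \<subseteq> cspan B" "card B = cdim (generalized_eigenspace T z)"
    by (rule complex_vector.basis_exists)
  ultimately have "finite B" "B \<noteq> {}"
    using complex_vector.independent_span_bound[OF F(1) B(2)] x(1) by auto
  then have "card B \<ge> 1" by (simp add: Suc_leI card_gt_0_iff)
  then show ?thesis using B(4) by (simp add: alg_mult_def)
qed

text \<open>A bound that is uniform over the finite sets of eigenvalues also shows that there
  are only finitely many, since each of them contributes at least one to the sum.\<close>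

lemma eigenvalue_count_le:
  assumes "\<And>D. finite D \<Longrightarrow> (\<And>z. z \<in> D \<Longrightarrow> s < cmod z \<and> finite_alg_mult T z)
      \<Longrightarrow> real (\<Sum>z\<in>D. alg_mult T z) \<le> R"
  shows "ereal_of_enat (eigenvalue_count T s) \<le> ereal R"
proof -
  define E where "E = {z \<in> discrete_spectrum T. cmod z > s}"
  have E: "s < cmod z \<and> finite_alg_mult T z" "alg_mult T z \<ge> 1" if "z \<in> E" for z
    using that alg_mult_pos by (auto simp: E_def discrete_spectrum_def)
  have "finite E"
  proof (rule finite_if_finite_subsets_card_bdd[THEN conjunct1])
    fix G assume G: "G \<subseteq> E" "finite G"
    have "card G = (\<Sum>z\<in>G. 1)" by simp
    also have "\<dots> \<le> (\<Sum>z\<in>G. alg_mult T z)" using E(2) G(1) by (intro sum_mono) auto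
    finally have "real (card G) \<le> R" using assms[of G] E(1) G by (meson of_nat_le_iff order_trans subsetD)
    then show "card G \<le> nat \<lfloor>R\<rfloor>" by linarith
  qed
  then show ?thesis
    using assms[of E] E(1) by (simp add: eigenvalue_count_def E_def[symmetric])
qed


section \<open>Choice of the parameter\<close>

lemma Lambert_W:
  assumes "y \<ge> 0"
  shows "Lambert_W y \<ge> 0 \<and> Lambert_W y * exp (Lambert_W y) = y"
proof -
  have mono: "v * exp v < w * exp w" if "0 \<le> v" "v < w" for v w :: real
    using that by (intro mult_strict_mono) auto
  have "y * 1 \<le> y * exp y" using assms by (intro mult_left_mono) auto
  then have "\<exists>w. 0 \<le> w \<and> w \<le> y \<and> w * exp w = y"
    using assms by (intro IVT') (auto intro!: continuous_intros)
  then obtain w where w: "0 \<le> w" "w * exp w = y" by blast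
  moreover have "v = w" if "0 \<le> v" "v * exp v = y" for v
    using mono[of v w] mono[of w v] that w by (cases v w rule: linorder_cases) auto
  ultimately have "\<exists>!w. w \<ge> 0 \<and> w * exp w = y" by blast
  then show ?thesis unfolding Lambert_W_def by (rule theI')
qed

text \<open>The function \<open>t \<mapsto> t * (exp (- t) - x) powr p\<close> has its maximum where
  \<open>(1 - p * t) * exp (- t) = x\<close>. For \<open>w = 1 / p - t\<close> this is the equation
  \<open>w * exp w = exp (1 / p) * x / p\<close>, so that the Lambert function solves it, and \<open>Phi p x\<close> is
  the reciprocal of the maximum.\<close>

lemma Phi_eq_inverse_at_maximizer:
  assumes p: "p > 0" and x: "0 \<le> x" "x < 1"
  obtains t where "t > 0" "exp (- t) > x" "Phi p x = 1 / (t * (exp (- t) - x) powr p)"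
proof (cases "x = 0")
  case True
  have "exp (- (1 / p)) powr p = exp (- 1)" using p by (simp add: powr_def)
  then have "Phi p x = 1 / (1 / p * (exp (- (1 / p)) - x) powr p)"
    using p True by (simp add: Phi_def exp_minus divide_inverse)
  then show ?thesis using p True that[of "1 / p"] by simp
next
  case False
  define w where "w = Lambert_W (1 / p * exp (1 / p) * x)"
  define t where "t = 1 / p - w"
  have w: "w \<ge> 0" "w * exp w = 1 / p * exp (1 / p) * x"
    using Lambert_W[of "1 / p * exp (1 / p) * x"] p x by (auto simp: w_def)
  have w0: "w > 0" 
  proof (rule ccontr)
    assume "\<not> w > 0"
    then have "w = 0" using w(1) by simp
    then show False using w(2) p False by simp
  qed
  have "t > 0"
  proof (rule ccontr)
    assume "\<not> t > 0"
    then have "1 / p \<le> w" by (simp add: t_def)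
    then have "1 / p * exp (1 / p) \<le> w * exp w" using p w(1) by (intro mult_mono) auto
    then have "(1 / p * exp (1 / p)) * 1 \<le> (1 / p * exp (1 / p)) * x" using w(2) by simp
    moreover have "0 < 1 / p * exp (1 / p)" using p by simp
    ultimately have "1 \<le> x" by (simp only: mult_le_cancel_left_pos)
    then show False using x by simp
  qed
  have "exp w = exp (1 / p) * exp (- t)" by (simp add: t_def exp_add[symmetric])
  then have "exp (1 / p) * (w * exp (- t)) = exp (1 / p) * (x / p)" using w(2) by (simp add: field_simps)
  then have "w * exp (- t) = x / p" by (simp only: mult_cancel_left exp_not_eq_zero simp_thms)
  then have diff: "exp (- t) - x = t * x / w"
    using w0 p by (simp add: t_def field_simps)
  have "t * (t * x / w) powr p = t powr (p + 1) * x powr p / w powr p"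
    using \<open>t > 0\<close> w0 x False by (simp add: powr_mult powr_divide powr_add)
  moreover have "Phi p x = w powr p / (t powr (p + 1) * x powr p)"
    unfolding Phi_def t_def w_def Let_def using False by (simp only: if_False)
  ultimately have "Phi p x = 1 / (t * (exp (- t) - x) powr p)"
    unfolding diff by simp
  moreover have "exp (- t) > x"
  proof -
    have "0 < t * x / w" using \<open>t > 0\<close> w0 x False by simp
    then show ?thesis using diff by linarith
  qed
  ultimately show ?thesis using \<open>t > 0\<close> that by blast
qed

theorem theorem1:
  fixes A K :: "'a::complex_banach \<Rightarrow> 'a" and p :: real
  assumes "bounded_clinear A"
    and "p > 0"
    and "K \<in> entropy_class p"
  shows "(\<forall>s > onorm A.
            ereal_of_enat (eigenvalue_count (\<lambda>x. A x + K x) s)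
              \<le> ereal (ln 2 / 2 * (Phi p (onorm A / s) / s powr p) * entropy_quasinorm p K powr p))
       \<and> (\<forall>s > onorm A.
            ereal_of_enat (eigenvalue_count (\<lambda>x. A x + K x) s)
              \<le> ereal (ln 2 * (p + 1) powr (p + 1) / (2 * p powr p)
                        * (s / (s - onorm A) powr (p + 1)) * entropy_quasinorm p K powr p))"
proof (intro conjI allI impI)
  fix s assume sa: "s > onorm A"
  define a where "a = onorm A"
  have a: "0 \<le> a" "a < s" "s > 0"
    using sa onorm_pos_le[OF bounded_clinear_imp_bounded_linear[OF assms(1)]] by (auto simp: a_def)
  have bound: "ereal_of_enat (eigenvalue_count (\<lambda>x. A x + K x) s)
      \<le> ereal (ln 2 / 2 * (1 / (t * (s * exp (- t) - a) powr p)) * entropy_quasinorm p K powr p)"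
    if "t > 0" "s * exp (- t) > a" for t
    using that total_multiplicity_le[OF assms _ _ a(3)] unfolding a_def
    by (intro eigenvalue_count_le) auto
  show "ereal_of_enat (eigenvalue_count (\<lambda>x. A x + K x) s)
      \<le> ereal (ln 2 / 2 * (Phi p (onorm A / s) / s powr p) * entropy_quasinorm p K powr p)"
  proof -
    obtain t where t: "t > 0" "exp (- t) > a / s"
      "Phi p (a / s) = 1 / (t * (exp (- t) - a / s) powr p)"
      using Phi_eq_inverse_at_maximizer[of p "a / s"] assms(2) a by auto
    have "(s * exp (- t) - a) powr p = (s * (exp (- t) - a / s)) powr p"
      using a(3) by (simp add: right_diff_distrib)
    also have "\<dots> = s powr p * (exp (- t) - a / s) powr p"
      using a(3) t(2) by (intro powr_mult)
    finally have "1 / (t * (s * exp (- t) - a) powr p) = Phi p (a / s) / s powr p"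
      by (simp add: t(3) mult_ac)
    moreover have "s * exp (- t) > a" using t(2) a(3) by (simp add: field_simps)
    ultimately show ?thesis using bound[of t] t(1) by (simp add: a_def)
  qed
  show "ereal_of_enat (eigenvalue_count (\<lambda>x. A x + K x) s)
      \<le> ereal (ln 2 * (p + 1) powr (p + 1) / (2 * p powr p)
                * (s / (s - onorm A) powr (p + 1)) * entropy_quasinorm p K powr p)"
  proof -
    \<comment> \<open>the maximizer of \<open>t * (1 - t - a / s) powr p\<close>, where \<open>1 - t\<close> is a lower bound for \<open>exp (- t)\<close>\<close>
    define t where "t = (s - a) / (s * (p + 1))"
    define v where "v = (s - a) * p / (p + 1)"
    have t: "t > 0" and v: "v > 0" using a assms(2) by (simp_all add: t_def v_def)
    have "s * t = (s - a) / (p + 1)" using a(3) by (simp add: t_def)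
    then have "v = s * (1 - t) - a"
      using assms(2) by (simp add: v_def field_simps)
    also have "\<dots> \<le> s * exp (- t) - a"
      using exp_ge_add_one_self[of "- t"] a(3) by simp
    finally have vle: "v \<le> s * exp (- t) - a" .
    have tv: "t * v powr p = (s - a) powr (p + 1) * p powr p / (s * (p + 1) powr (p + 1))"
      using a assms(2) by (simp add: t_def v_def powr_divide powr_mult powr_add mult_ac)
    have "1 / (t * (s * exp (- t) - a) powr p) \<le> 1 / (t * v powr p)"
      using t v vle assms(2) by (intro divide_left_mono mult_left_mono powr_mono2 mult_pos_pos) auto
    also have "\<dots> = (p + 1) powr (p + 1) / p powr p * (s / (s - a) powr (p + 1))"
      unfolding tv by (simp add: field_simps)
    finally have "ln 2 / 2 * (1 / (t * (s * exp (- t) - a) powr p)) * entropy_quasinorm p K powr p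
        \<le> ln 2 / 2 * ((p + 1) powr (p + 1) / p powr p * (s / (s - a) powr (p + 1)))
            * entropy_quasinorm p K powr p"
      by (intro mult_right_mono mult_left_mono) auto
    also have "\<dots> = ln 2 * (p + 1) powr (p + 1) / (2 * p powr p)
        * (s / (s - a) powr (p + 1)) * entropy_quasinorm p K powr p"
      by simp
    finally have final: "ln 2 / 2 * (1 / (t * (s * exp (- t) - a) powr p)) * entropy_quasinorm p K powr p
        \<le> ln 2 * (p + 1) powr (p + 1) / (2 * p powr p)
            * (s / (s - a) powr (p + 1)) * entropy_quasinorm p K powr p" .
    show ?thesis
    proof -
      have "s * exp (- t) > a" using v vle by linarith
      from order_trans[OF bound[OF t this]] final show ?thesis
        unfolding a_def by (simp only: ereal_less_eq(3))
    qed
  qed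
qed

end
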